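(* Let $d\ge 1$, let $\boldsymbol n=(n_1,\dots,n_d)\in\mathbb N_0^d$ with $n=\sum_i n_i$, let $s>0$, and set $u_i^0:=\frac{n_i}{n+s}$ and $\Delta':=\{\boldsymbol u\in\mathbb R^d: u_i\ge u_i^0\ \forall i,\ \sum_i u_i=1\}$. Let $f:[0,1]\to\mathbb R$ be concave and let $F:\Delta'\to\mathbb R$ be the (concave) function $F(\boldsymbol u)=\sum_{i=1}^d f(u_i)$. Then: (i) $F$ attains its global maximum over $\Delta'$ at the point $\boldsymbol u^{\overline F}$ given by $$u_i^{\overline F}=\max\{u_i^0,\tilde u\},\qquad \tilde u:=\min_{m\in\{1,\dots,d\}}\frac{s+\sum_{k\le m} n_{i_k}}{m(n+s)},$$ where $i_1,\dots,i_d$ is an ordering of $\{1,\dots,d\}$ with $n_{i_1}\le n_{i_2}\le\dots\le n_{i_d}$. (ii) $F$ attains its global minimum over $\Delta'$ at the point $\boldsymbol u^{\underline F}$ given by $$u_i^{\underline F}=\frac{n_i+s\,\delta_{i\,i^{\underline F}}}{n+s},\qquad i^{\underline F}:=\arg\max_i n_i .$$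
   Context: $\delta_{ij}$ is Kronecker's delta. Ties in $\arg\max_i n_i$ are broken arbitrarily. The set $\Delta'$ is the image of the simplex $\Delta=\{\boldsymbol t\in\mathbb R^d: t_i\ge0\ \forall i,\ \sum_i t_i=1\}$ under the map $u_i=\frac{n_i+st_i}{n+s}$. *)

theory Defs
  imports "HOL-Analysis.Analysis"
begin

definition total :: "nat ^ 'd::finite \<Rightarrow> nat" where
  "total n = (\<Sum>i\<in>UNIV. n $ i)"

definition u0 :: "nat ^ 'd::finite \<Rightarrow> real \<Rightarrow> real ^ 'd" where
  "u0 n s = (\<chi> i. real (n $ i) / (real (total n) + s))"

definition Delta' :: "nat ^ 'd::finite \<Rightarrow> real \<Rightarrow> (real ^ 'd) set" where
  "Delta' n s = {u. (\<forall>i. u $ i \<ge> u0 n s $ i) \<and> (\<Sum>i\<in>UNIV. u $ i) = 1}"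

definition sumF :: "(real \<Rightarrow> real) \<Rightarrow> real ^ 'd::finite \<Rightarrow> real" where
  "sumF f u = (\<Sum>i\<in>UNIV. f (u $ i))"

definition attains_max_at :: "('a \<Rightarrow> real) \<Rightarrow> 'a set \<Rightarrow> 'a \<Rightarrow> bool" where
  "attains_max_at F S x \<longleftrightarrow> x \<in> S \<and> (\<forall>y\<in>S. F y \<le> F x)"

definition attains_min_at :: "('a \<Rightarrow> real) \<Rightarrow> 'a set \<Rightarrow> 'a \<Rightarrow> bool" where
  "attains_min_at F S x \<longleftrightarrow> x \<in> S \<and> (\<forall>y\<in>S. F x \<le> F y)"

text \<open>The ordering \<open>i\<^sub>1, \<dots>, i\<^sub>d\<close> of the coordinates is the function \<open>k \<mapsto> i\<^sub>k\<close>, of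
  which only the values on \<open>{1..d}\<close> matter; ties may be ordered in any way.\<close>

definition sorts :: "nat ^ 'd::finite \<Rightarrow> (nat \<Rightarrow> 'd) \<Rightarrow> bool" where
  "sorts n \<sigma> \<longleftrightarrow> bij_betw \<sigma> {1..CARD('d)} UNIV \<and> mono_on {1..CARD('d)} (\<lambda>k. n $ \<sigma> k)"

definition u_tilde :: "nat ^ 'd::finite \<Rightarrow> real \<Rightarrow> (nat \<Rightarrow> 'd) \<Rightarrow> real" where
  "u_tilde n s \<sigma> = (MIN m\<in>{1..CARD('d)}.
     (s + (\<Sum>k=1..m. real (n $ \<sigma> k))) / (real m * (real (total n) + s)))"

definition u_upper :: "nat ^ 'd::finite \<Rightarrow> real \<Rightarrow> (nat \<Rightarrow> 'd) \<Rightarrow> real ^ 'd" where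
  "u_upper n s \<sigma> = (\<chi> i. max (u0 n s $ i) (u_tilde n s \<sigma>))"

definition u_lower :: "nat ^ 'd::finite \<Rightarrow> real \<Rightarrow> 'd \<Rightarrow> real ^ 'd" where
  "u_lower n s j = (\<chi> i. (real (n $ i) + s * (if i = j then 1 else 0)) / (real (total n) + s))"

end

theory Submission imports Defs begin

text \<open>Maximum: the point \<open>u_upper\<close> is the water-filling point \<open>max (a i) c\<close> whose level \<open>c\<close> is
  chosen so that the coordinates sum to 1. A supergradient \<open>g\<close> of \<open>f\<close> at \<open>c\<close> satisfies
  \<open>f (u i) - f (max (a i) c) \<le> g * (u i - max (a i) c)\<close> for every feasible \<open>u\<close>, and the right-hand
  sides sum to 0. Minimum: if \<open>a j\<close> is maximal, every increment
  \<open>f (u i) - f (a i)\<close> is at least \<open>u i - a i\<close> times the slope of the chord of \<open>f\<close> over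
  \<open>[a j, a j + r]\<close>, where \<open>r\<close> is the total mass to be distributed.\<close>

text \<open>The point \<open>y\<close> is the convex combination of \<open>x\<close> and
  \<open>z\<close> with weight \<open>(y - x) / (z - x)\<close>. With that denominator cleared,
  slopes of chords can be compared by multiplication alone, even when \<open>y\<close> is an
  endpoint.\<close>

lemma concave_three_points:
  fixes f :: "real \<Rightarrow> real"
  assumes "concave_on S f" "x \<in> S" "z \<in> S" "x \<le> y" "y \<le> z"
  shows "(z - y) * f x + (y - x) * f z \<le> (z - x) * f y"
proof (cases "x = z")
  case True
  with assms show ?thesis by auto
next
  case False
  with assms have lt: "0 < z - x" by simp
  define t where "t = (y - x) / (z - x)"
  have t: "0 \<le> t" "t \<le> 1" using lt assms by (auto simp: t_def)
  have tz: "t * (z - x) = y - x" using lt by (simp add: t_def)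
  have y: "y = (1 - t) * x + t * z" using tz by (simp add: algebra_simps)
  from concave_onD[OF assms(1) t assms(2,3)]
  have "(1 - t) * f x + t * f z \<le> f y" by (simp add: y)
  hence "(z - x) * ((1 - t) * f x + t * f z) \<le> (z - x) * f y"
    using lt by (intro mult_left_mono) auto
  moreover have "(z - x) * ((1 - t) * f x + t * f z)
      = ((z - x) - t * (z - x)) * f x + (t * (z - x)) * f z"
    by (simp add: algebra_simps)
  ultimately show ?thesis by (simp add: tz)
qed

text \<open>A subgradient of the convex function \<open>- f\<close>, negated. The point must be
  interior: at an endpoint the slope of \<open>f\<close> can be infinite.\<close>

lemma concave_on_imp_supergradient:
  fixes f :: "real \<Rightarrow> real"
  assumes "concave_on S f" "c \<in> interior S"
  obtains g where "\<And>x. x \<in> S \<Longrightarrow> f x \<le> f c + g * (x - c)"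
proof -
  have "convex_on S (\<lambda>x. - f x)" using assms(1) by (simp add: concave_on_def)
  from convex_le_Inf_differential[OF this assms(2)]
  obtain g where "\<And>x. x \<in> S \<Longrightarrow> - f x \<ge> - f c + g * (x - c)" by blast
  hence "f x \<le> f c + (- g) * (x - c)" if "x \<in> S" for x using that by force
  thus ?thesis by (rule that)
qed

lemma sum_concave_le_water_filling:
  fixes f :: "real \<Rightarrow> real" and a u :: "'a \<Rightarrow> real"
  assumes f: "concave_on {0..1} f" and c: "0 < c"
    and I: "finite I"
    and u: "\<And>i. i \<in> I \<Longrightarrow> a i \<le> u i" "\<And>i. i \<in> I \<Longrightarrow> u i \<in> {0..1}"
    and sum_eq: "(\<Sum>i\<in>I. u i) = (\<Sum>i\<in>I. max (a i) c)"
  shows "(\<Sum>i\<in>I. f (u i)) \<le> (\<Sum>i\<in>I. f (max (a i) c))"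
proof (cases "c < 1")
  \<comment> \<open>Here \<open>c\<close> is not interior to the unit interval, so a supergradient
    may be missing. But \<open>u i \<le> 1 \<le> c\<close>, so the equality of the two sums forces
    \<open>u i = max (a i) c\<close> for every \<open>i\<close>.\<close>
  case False
  have nonneg: "0 \<le> max (a i) c - u i" if "i \<in> I" for i
    using u(2)[OF that] False by auto
  have "(\<Sum>i\<in>I. max (a i) c - u i) = 0" using sum_eq by (simp add: sum_subtractf)
  hence "u i = max (a i) c" if "i \<in> I" for i
    using sum_nonneg_eq_0_iff[OF I nonneg] that by simp
  thus ?thesis by simp
next
  case True
  with c have cint: "c \<in> interior {0..1}" and c01: "c \<in> {0..1}" by auto
  obtain g where g: "\<And>x. x \<in> {0..1} \<Longrightarrow> f x \<le> f c + g * (x - c)"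
    using concave_on_imp_supergradient[OF f cint] by blast
  have "f (u i) - f (max (a i) c) \<le> g * (u i - max (a i) c)" if i: "i \<in> I" for i
  proof (cases "c < a i")
    case False
    thus ?thesis using g[OF u(2)[OF i]] by (simp add: max_def)
  next
    \<comment> \<open>Now \<open>c < a i \<le> u i\<close>. The slope of \<open>f\<close> over
      \<open>[a i, u i]\<close> is at most its slope over \<open>[c, u i]\<close>, which is at most
      \<open>g\<close>.\<close>
    case ca: True
    let ?a = "a i" and ?u = "u i"
    have lt: "0 < ?u - c" using ca u(1)[OF i] by simp
    have "(?u - ?a) * f c + (?a - c) * f ?u \<le> (?u - c) * f ?a"
      using concave_three_points[OF f c01 u(2)[OF i]] ca u(1)[OF i] by simp
    hence "(?u - c) * (f ?u - f ?a) \<le> (?u - ?a) * (f ?u - f c)"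
      by (simp add: algebra_simps)
    also have "\<dots> \<le> (?u - ?a) * (g * (?u - c))"
      using g[OF u(2)[OF i]] u(1)[OF i] by (intro mult_left_mono) auto
    finally have "(?u - c) * (f ?u - f ?a) \<le> (?u - c) * (g * (?u - ?a))"
      by (simp add: mult_ac)
    hence "f ?u - f ?a \<le> g * (?u - ?a)" using lt by simp
    thus ?thesis using ca by (simp add: max_def)
  qed
  hence "(\<Sum>i\<in>I. f (u i) - f (max (a i) c)) \<le> (\<Sum>i\<in>I. g * (u i - max (a i) c))"
    by (rule sum_mono)
  also have "\<dots> = 0" using sum_eq by (simp add: sum_subtractf flip: sum_distrib_left)
  finally show ?thesis by (simp add: sum_subtractf)
qed

lemma sum_concave_ge_concentrated:
  fixes f :: "real \<Rightarrow> real" and a u :: "'a \<Rightarrow> real"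
  assumes f: "concave_on {0..1} f" and r: "0 < r"
    and I: "finite I" and j: "j \<in> I"
    and a: "\<And>i. i \<in> I \<Longrightarrow> 0 \<le> a i" "\<And>i. i \<in> I \<Longrightarrow> a i \<le> a j" "a j + r \<le> 1"
    and u: "\<And>i. i \<in> I \<Longrightarrow> a i \<le> u i" "(\<Sum>i\<in>I. u i) = (\<Sum>i\<in>I. a i) + r"
  shows "(\<Sum>i\<in>I. f (if i = j then a i + r else a i)) \<le> (\<Sum>i\<in>I. f (u i))"
proof -
  define M where "M = a j + r"
  define D where "D = f M - f (a j)"
  have M1: "M \<le> 1" using a(3) by (simp add: M_def)
  have key: "(u i - a i) * D \<le> r * (f (u i) - f (a i))" if i: "i \<in> I" for i
  proof -
    let ?a = "a i"
    \<comment> \<open>All increments are nonnegative and add up to \<open>r\<close>, so none exceeds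
      \<open>r\<close>; this places \<open>u i\<close> below \<open>M\<close>.\<close>
    have "u i - ?a \<le> (\<Sum>i\<in>I. u i - a i)"
      using u(1) I i by (intro member_le_sum) auto
    hence ur: "u i \<le> ?a + r" using u(2) by (simp add: sum_subtractf)
    have rng: "?a \<in> {0..1}" "M \<in> {0..1}"
      using a(1)[OF i] a(2)[OF i] M1 r by (auto simp: M_def)
    have uM: "u i \<le> M" and lt: "0 < M - ?a"
      using ur a(2)[OF i] r by (auto simp: M_def)
    \<comment> \<open>The chord over \<open>[a i, M]\<close> is the link: its slope is at most that
      over \<open>[a i, u i]\<close> by 1, and at least \<open>D / r\<close>, the slope over
      \<open>[a j, M]\<close>, by 2.\<close>
    have 1: "(M - u i) * f ?a + (u i - ?a) * f M \<le> (M - ?a) * f (u i)"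
      using concave_three_points[OF f rng u(1)[OF i] uM] .
    have 2: "(M - a j) * f ?a + (a j - ?a) * f M \<le> (M - ?a) * f (a j)"
      using concave_three_points[OF f rng a(2)[OF i]] r by (simp add: M_def)
    have "(u i - ?a) * ((M - ?a) * D) \<le> (u i - ?a) * (r * (f M - f ?a))"
      using 2 u(1)[OF i] by (intro mult_left_mono) (auto simp: D_def M_def algebra_simps)
    also have "\<dots> = r * ((u i - ?a) * (f M - f ?a))" by simp
    also have "\<dots> \<le> r * ((M - ?a) * (f (u i) - f ?a))"
      using 1 r by (intro mult_left_mono) (auto simp: algebra_simps)
    finally have "(M - ?a) * ((u i - ?a) * D) \<le> (M - ?a) * (r * (f (u i) - f ?a))"
      by (simp add: mult_ac)
    thus ?thesis using lt by simp
  qed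
  have "r * D = (\<Sum>i\<in>I. (u i - a i) * D)"
    using u(2) by (simp add: sum_subtractf flip: sum_distrib_right)
  also have "\<dots> \<le> (\<Sum>i\<in>I. r * (f (u i) - f (a i)))" using key by (rule sum_mono)
  also have "\<dots> = r * ((\<Sum>i\<in>I. f (u i)) - (\<Sum>i\<in>I. f (a i)))"
    by (simp add: sum_subtractf flip: sum_distrib_left)
  finally have "D \<le> (\<Sum>i\<in>I. f (u i)) - (\<Sum>i\<in>I. f (a i))" using r by simp
  moreover have "(\<Sum>i\<in>I. f (if i = j then a i + r else a i)) = (\<Sum>i\<in>I. f (a i)) + D"
    using I j by (simp add: sum.remove[of I j] D_def M_def)
  ultimately show ?thesis by simp
qed

text \<open>The \<open>m\<close>-th quotient is the level reached when mass \<open>s\<close> raises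
  the first \<open>m\<close> entries to a common height. At a minimising \<open>m\<close>,
  comparison with \<open>m - 1\<close> and \<open>m + 1\<close> gives \<open>b m \<le> c\<close>,
  and \<open>c \<le> b (m + 1)\<close> if \<open>m < d\<close>. So exactly the first
  \<open>m\<close> entries are filled, up to \<open>c\<close>.\<close>

lemma sum_max_Min_average:
  fixes b :: "nat \<Rightarrow> real"
  assumes d: "0 < d" and s: "0 \<le> s" and b: "mono_on {1..d} b"
  defines "c \<equiv> (MIN m\<in>{1..d}. (s + (\<Sum>k=1..m. b k)) / real m)"
  shows "(\<Sum>k=1..d. max (b k) c) = s + (\<Sum>k=1..d. b k)"
proof -
  let ?A = "\<lambda>m. s + (\<Sum>k=1..m. b k)"
  let ?Q = "(\<lambda>m. ?A m / real m) ` {1..d}"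
  have Q: "finite ?Q" "?Q \<noteq> {}" using d by auto
  \<comment> \<open>The index 0 is included, where the claim is \<open>0 \<le> s\<close>: it serves
    as the predecessor when the minimum is attained at 1.\<close>
  have A_ge: "real m * c \<le> ?A m" if "m \<le> d" for m
  proof (cases "m = 0")
    case False
    hence "c \<le> ?A m / real m" unfolding c_def using that Q by (intro Min_le) auto
    thus ?thesis using False by (simp add: field_simps)
  qed (use s in simp)
  have "c \<in> ?Q" unfolding c_def using Q by (rule Min_in)
  then obtain m where m: "1 \<le> m" "m \<le> d" "c = ?A m / real m" by auto
  hence Am: "?A m = real m * c" by simp
  have low: "b k \<le> c" if k: "k \<in> {1..m}" for k
  proof -
    obtain m' where m': "m = Suc m'" using m by (cases m) auto
    have "b k \<le> b m" using k m by (intro mono_onD[OF b]) auto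
    \<comment> \<open>\<open>b m\<close> is the difference of \<open>?A m = m * c\<close> and
      \<open>?A m' \<ge> m' * c\<close>.\<close>
    also have "b m \<le> c" using A_ge[of m'] Am m(2) m' by (simp add: algebra_simps)
    finally show ?thesis .
  qed
  have high: "c \<le> b k" if k: "k \<in> {m<..d}" for k
  proof -
    have "c \<le> b (Suc m)" using A_ge[of "Suc m"] Am k by (simp add: algebra_simps)
    also have "\<dots> \<le> b k" using k by (intro mono_onD[OF b]) auto
    finally show ?thesis .
  qed
  have split: "(\<Sum>k=1..d. h k) = (\<Sum>k=1..m. h k) + (\<Sum>k\<in>{m<..d}. h k)" for h :: "nat \<Rightarrow> real"
  proof -
    have "{1..d} = {1..m} \<union> {m<..d}" using m by auto
    thus ?thesis by (simp only:) (rule sum.union_disjoint, auto)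
  qed
  have "(\<Sum>k=1..m. max (b k) c) = real m * c" using low by (simp add: max_absorb2)
  moreover have "(\<Sum>k\<in>{m<..d}. max (b k) c) = (\<Sum>k\<in>{m<..d}. b k)"
    using high by (simp add: max_absorb1)
  ultimately show ?thesis using split[of b] split[of "\<lambda>k. max (b k) c"] Am by simp
qed

lemma Delta'_in_unit_interval:
  assumes "s > 0" "u \<in> Delta' n s"
  shows "u $ i \<in> {0..1}"
proof -
  have nonneg: "0 \<le> u $ k" for k
  proof -
    have "0 \<le> u0 n s $ k" using assms by (simp add: u0_def)
    also have "\<dots> \<le> u $ k" using assms by (simp add: Delta'_def)
    finally show ?thesis .
  qed
  have "u $ i \<le> (\<Sum>k\<in>UNIV. u $ k)" using nonneg by (intro member_le_sum) auto
  thus ?thesis using nonneg assms by (simp add: Delta'_def)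
qed

text \<open>The second summand is the mass left to distribute above the lower bounds.\<close>

lemma sum_u0:
  assumes "s > 0"
  shows "(\<Sum>i\<in>UNIV. u0 n s $ i) + s / (real (total n) + s) = 1"
proof -
  have "0 < real (total n) + s" using assms by (intro add_nonneg_pos) auto
  moreover have "(\<Sum>i\<in>UNIV. u0 n s $ i) = real (total n) / (real (total n) + s)"
    by (simp add: u0_def total_def flip: sum_divide_distrib)
  ultimately show ?thesis by (simp flip: add_divide_distrib)
qed

text \<open>Keeps the water level off the endpoint 0, as \<open>sum_concave_le_water_filling\<close>
  requires.\<close>

lemma u_tilde_pos:
  fixes n :: "nat ^ 'd::finite"
  assumes "s > 0"
  shows "0 < u_tilde n s \<sigma>"
proof -
  have "0 < (s + (\<Sum>k=1..m. real (n $ \<sigma> k))) / (real m * (real (total n) + s))" if "1 \<le> m" for m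
    using that assms by (intro divide_pos_pos mult_pos_pos add_pos_nonneg add_nonneg_pos sum_nonneg) auto
  thus ?thesis by (auto simp: u_tilde_def Min_gr_iff Suc_le_eq)
qed

lemma sum_u_upper:
  fixes n :: "nat ^ 'd::finite"
  assumes s: "s > 0" and \<sigma>: "sorts n \<sigma>"
  shows "(\<Sum>i\<in>UNIV. u_upper n s \<sigma> $ i) = 1"
proof -
  define N where "N = real (total n) + s"
  have N: "0 < N" unfolding N_def using s by (intro add_nonneg_pos) auto
  have bij: "bij_betw \<sigma> {1..CARD('d)} UNIV"
    and mono: "mono_on {1..CARD('d)} (\<lambda>k. n $ \<sigma> k)"
    using \<sigma> by (auto simp: sorts_def)
  define b where "b k = u0 n s $ \<sigma> k" for k
  have b: "b k = real (n $ \<sigma> k) / N" for k by (simp add: b_def u0_def N_def)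
  have "mono_on {1..CARD('d)} b"
    using mono N by (auto simp: mono_on_def b divide_right_mono)
  \<comment> \<open>Moving the factor \<open>N\<close> into the numerator turns the level into that
    of \<open>sum_max_Min_average\<close>, with mass \<open>s / N\<close> and the sorted entries
    \<open>b\<close>.\<close>
  moreover have "u_tilde n s \<sigma> = (MIN m\<in>{1..CARD('d)}. (s / N + (\<Sum>k=1..m. b k)) / real m)"
    unfolding u_tilde_def N_def[symmetric]
    by (simp add: b mult.commute flip: sum_divide_distrib add_divide_distrib)
  ultimately have "(\<Sum>k=1..CARD('d). max (b k) (u_tilde n s \<sigma>)) = s / N + (\<Sum>k=1..CARD('d). b k)"
    using sum_max_Min_average[of "CARD('d)" "s / N" b] s N by simp
  thus ?thesis
    using sum_u0[OF s, of n]
      sum.reindex_bij_betw[OF bij, of "\<lambda>i. max (u0 n s $ i) (u_tilde n s \<sigma>)"]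
      sum.reindex_bij_betw[OF bij, of "\<lambda>i. u0 n s $ i"]
    by (simp add: u_upper_def b_def N_def)
qed

theorem theorem1:
  fixes n :: "nat ^ 'd::finite" and s :: real and f :: "real \<Rightarrow> real"
  assumes "s > 0"
    and "concave_on {0..1} f"
  shows "(\<forall>\<sigma>. sorts n \<sigma> \<longrightarrow> attains_max_at (sumF f) (Delta' n s) (u_upper n s \<sigma>)) \<and>
    (\<forall>j. is_arg_max (\<lambda>i. n $ i) (\<lambda>_. True) j \<longrightarrow>
      attains_min_at (sumF f) (Delta' n s) (u_lower n s j))"
proof (intro conjI allI impI)
  fix \<sigma> assume \<sigma>: "sorts n \<sigma>"
  have "u_upper n s \<sigma> \<in> Delta' n s"
    using sum_u_upper[OF assms(1) \<sigma>] by (simp add: Delta'_def u_upper_def)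
  moreover have "sumF f u \<le> sumF f (u_upper n s \<sigma>)" if u: "u \<in> Delta' n s" for u
  proof -
    have "(\<Sum>i\<in>UNIV. f (u $ i)) \<le> (\<Sum>i\<in>UNIV. f (max (u0 n s $ i) (u_tilde n s \<sigma>)))"
    proof (rule sum_concave_le_water_filling[OF assms(2) u_tilde_pos[OF assms(1)]])
      show "u0 n s $ i \<le> u $ i" for i using u by (simp add: Delta'_def)
      show "u $ i \<in> {0..1}" for i by (rule Delta'_in_unit_interval[OF assms(1) u])
      show "(\<Sum>i\<in>UNIV. u $ i) = (\<Sum>i\<in>UNIV. max (u0 n s $ i) (u_tilde n s \<sigma>))"
        using u sum_u_upper[OF assms(1) \<sigma>] by (simp add: Delta'_def u_upper_def)
    qed simp
    thus ?thesis by (simp add: sumF_def u_upper_def)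
  qed
  ultimately show "attains_max_at (sumF f) (Delta' n s) (u_upper n s \<sigma>)"
    by (simp add: attains_max_at_def)
next
  fix j assume j: "is_arg_max (\<lambda>i. n $ i) (\<lambda>_. True) j"
  define r where "r = s / (real (total n) + s)"
  have N: "0 < real (total n) + s" using assms(1) by (intro add_nonneg_pos) auto
  have r: "0 < r" using N assms(1) by (simp add: r_def)
  have low: "u_lower n s j $ i = (if i = j then u0 n s $ i + r else u0 n s $ i)" for i
    by (simp add: u_lower_def u0_def r_def add_divide_distrib)
  have "(\<Sum>i\<in>UNIV. u_lower n s j $ i) = (\<Sum>i\<in>UNIV. u0 n s $ i + (if i = j then r else 0))"
    by (intro sum.cong) (auto simp: low)
  also have "\<dots> = 1" using sum_u0[OF assms(1), of n] by (simp add: sum.distrib r_def)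
  finally have mem: "u_lower n s j \<in> Delta' n s"
    using r by (auto simp: Delta'_def low)
  moreover have "sumF f (u_lower n s j) \<le> sumF f u" if u: "u \<in> Delta' n s" for u
  proof -
    have "(\<Sum>i\<in>UNIV. f (if i = j then u0 n s $ i + r else u0 n s $ i)) \<le> (\<Sum>i\<in>UNIV. f (u $ i))"
    proof (rule sum_concave_ge_concentrated[OF assms(2) r])
      show "0 \<le> u0 n s $ i" for i using N by (simp add: u0_def)
      show "u0 n s $ i \<le> u0 n s $ j" for i
        using j N by (auto simp: u0_def is_arg_max_def not_less intro!: divide_right_mono)
      \<comment> \<open>The left-hand side is coordinate \<open>j\<close> of
        \<open>u_lower n s j\<close>, a point already shown to be feasible.\<close>
      show "u0 n s $ j + r \<le> 1"
        using Delta'_in_unit_interval[OF assms(1) mem, of j] by (simp add: low)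
      show "u0 n s $ i \<le> u $ i" for i using u by (simp add: Delta'_def)
      show "(\<Sum>i\<in>UNIV. u $ i) = (\<Sum>i\<in>UNIV. u0 n s $ i) + r"
        using u sum_u0[OF assms(1), of n] by (simp add: Delta'_def r_def)
    qed auto
    thus ?thesis by (simp add: sumF_def low)
  qed
  ultimately show "attains_min_at (sumF f) (Delta' n s) (u_lower n s j)"
    by (simp add: attains_min_at_def)
qed

end
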